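(* Let $C$ be a binary self-dual code of length $n$ with no codewords of weight $2$. Then: (i) $C$ has at least $n(22-n)/8$ codewords of weight $4$. (ii) Equality holds in (i) (that is, $C$ has exactly $n(22-n)/8$ codewords of weight $4$) if and only if the shadow of $C$ contains no words of weight $<(n-8)/2$. (iii) In that case (i.e. when the equivalent conditions of (ii) hold), the number of words of weight exactly $(n-8)/2$ in the shadow of $C$ is $2^{(n-14)/2}\,n$.
   Context: Let $F=\mathbb{Z}/2\mathbb{Z}$. The (Hamming) weight $\mathrm{wt}(w)$ of $w\in F^n$ is the number of nonzero coordinates of $w$. A binary self-dual code of length $n$ is a linear subspace $C\subset F^n$ which equals its own annihilator under the pairing $(v,w)=\sum_{j=1}^n v_jw_j\in F$; then $n$ is even and every word of $C$ has even weight. The map $C\to F$, $c\mapsto \tfrac12\mathrm{wt}(c) \bmod 2$, is linear. The shadow of $C$ is the coset $C'$ of $C$ in $F^n$ consisting of all $c'\in F^n$ such that $\tfrac12\mathrm{wt}(c)\equiv (c,c')\pmod 2$ for all $c\in C$. *)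

theory Defs
  imports "HOL-Analysis.Analysis" "HOL-Library.Z2"
begin

definition hamming_weight :: "bit ^ 'n \<Rightarrow> nat" where
  "hamming_weight w = card {j. w $ j \<noteq> 0}"

definition pairing :: "bit ^ 'n \<Rightarrow> bit ^ 'n \<Rightarrow> bit" where
  "pairing v w = (\<Sum>j\<in>UNIV. v $ j * w $ j)"

definition annihilator :: "(bit ^ 'n) set \<Rightarrow> (bit ^ 'n) set" where
  "annihilator C = {v. \<forall>w\<in>C. pairing v w = 0}"

definition self_dual_code :: "(bit ^ 'n) set \<Rightarrow> bool" where
  "self_dual_code C \<longleftrightarrow> vec.subspace C \<and> C = annihilator C"

text \<open>Only meant for self-dual codes: there every weight is even, so \<open>div\<close> is exact.
  The congruence modulo 2 is an equation in \<^typ>\<open>bit\<close>.\<close>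

definition shadow :: "(bit ^ 'n) set \<Rightarrow> (bit ^ 'n) set" where
  "shadow C = {c'. \<forall>c\<in>C. of_nat (hamming_weight c div 2) = pairing c c'}"

end

theory Submission imports Defs "HOL-Combinatorics.Multiset_Permutations" begin

text \<open>
  For a vector \<open>v\<close> of length \<open>n\<close> let \<open>t(v) = n - 2 wt(v)\<close>, the sum of the signs
  \<open>(-1) ^ v\<^sub>j\<close>; below it is called the imbalance. The theorem follows from the second and
  fourth moments of \<open>t\<close> over the shadow \<open>S\<close>, together with the fact that \<open>t\<close> takes only
  multiples of 8 as values on \<open>S\<close>.

  The indicator function of \<open>S\<close> is, up to a factor, the Fourier transform of the function that
  is \<open>(-1) ^ (wt(c) / 2)\<close> at \<open>c \<in> C\<close> and 0 outside \<open>C\<close>. Hence the sum of \<open>(-1) ^ (s, w)\<close>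
  over \<open>s \<in> S\<close> is \<open>|C| (-1) ^ (wt(w) / 2)\<close> if \<open>w \<in> C\<close>, and 0 otherwise
  (\<open>sum_shadow_pairing\<close>). A power \<open>t(s) ^ k\<close> expands into such signs, \<open>w\<close> running over the
  sums of \<open>k\<close> unit vectors. Since \<open>C\<close> has no word of weight 2, only \<open>w = 0\<close> contributes to the
  second moment, and only \<open>w = 0\<close> and the words of weight 4 contribute to the fourth. With
  \<open>N\<close> the number of words of weight 4, counting the expansions of each \<open>w\<close> gives

  \<open>\<Sum> t(s)\<^sup>2 = n |C|\<close> and \<open>\<Sum> t(s) ^ 4 = |C| (3 n\<^sup>2 - 2 n + 24 N)\<close>,

  and therefore \<open>\<Sum> t(s)\<^sup>2 (t(s)\<^sup>2 - 64) = 24 |C| (N - n (22 - n) / 8)\<close>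
  (\<open>sum_imbalance_quartic\<close>).

  A Gauss sum shows that \<open>wt(s) \<equiv> n / 2\<close> modulo 4 for all \<open>s \<in> S\<close>, so \<open>8\<close> divides \<open>t(s)\<close>
  (\<open>shadow_imbalance\<close>). No multiple of 8 lies strictly between 0 and 8 in absolute value, so
  every summand \<open>t\<^sup>2 (t\<^sup>2 - 64)\<close> is nonnegative, which proves (i). Equality means
  \<open>|t| \<le> 8\<close> on all of \<open>S\<close>. As \<open>S\<close> is closed under complementation, which changes the sign
  of \<open>t\<close>, this is the same as \<open>t \<le> 8\<close>, that is, \<open>wt \<ge> (n - 8) / 2\<close>; this is (ii). In that
  case \<open>t\<close> takes only the values \<open>0, 8, -8\<close> on \<open>S\<close>, with 8 and -8 equally often, so the
  second moment \<open>n |C| = n 2 ^ (n / 2)\<close> is 128 times the number of \<open>s\<close> with \<open>t(s) = 8\<close>;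
  this is (iii).
\<close>

section \<open>Signs and weights of binary vectors\<close>

lemma UNIV_bit: "(UNIV :: bit set) = {0, 1}"
  using bit.exhaust by blast

instance bit :: finite
  by standard (simp add: UNIV_bit)

definition bit_sign :: "bit \<Rightarrow> 'a::comm_ring_1" where
  "bit_sign b = (if b = 0 then 1 else - 1)"

lemma bit_sign_simps [simp]: "bit_sign 0 = 1" "bit_sign 1 = - 1"
  by (simp_all add: bit_sign_def)

lemma bit_sign_add: "bit_sign (a + b) = bit_sign a * bit_sign b"
  by (cases a; cases b) simp_all

lemma bit_sign_of_nat: "bit_sign (of_nat k) = (- 1) ^ k"
  by (induction k)
    (simp_all only: of_nat_0 of_nat_Suc bit_sign_add bit_sign_simps power_0 power_Suc)

definition half_weight :: "bit ^ 'n \<Rightarrow> bit" where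
  "half_weight v = of_nat (hamming_weight v div 2)"

definition imbalance :: "bit ^ 'n \<Rightarrow> real" where
  "imbalance v = (\<Sum>j\<in>UNIV. bit_sign (v $ j))"

lemma imbalance_eq:
  fixes v :: "bit ^ 'n"
  shows "imbalance v = real CARD('n) - 2 * real (hamming_weight v)"
proof -
  have "imbalance v = (\<Sum>j\<in>(UNIV::'n set). 1 - 2 * of_bool (v $ j \<noteq> 0))"
    unfolding imbalance_def by (intro sum.cong refl) (simp add: bit_sign_def)
  also have "\<dots> = real CARD('n) - 2 * (\<Sum>j\<in>(UNIV::'n set). of_bool (v $ j \<noteq> 0))"
    unfolding sum_subtractf sum_distrib_left[symmetric] by simp
  also have "(\<Sum>j\<in>(UNIV::'n set). of_bool (v $ j \<noteq> 0)) = real (hamming_weight v)"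
    unfolding hamming_weight_def by (simp del: bit_not_zero_iff)
  finally show ?thesis .
qed

lemma imbalance_complement: "imbalance (v + 1) = - imbalance v" for v :: "bit ^ 'n"
  unfolding imbalance_def sum_negf[symmetric]
  by (intro sum.cong) (simp_all add: bit_sign_add)

lemma vec_add_self [simp]: "v + v = (0 :: bit ^ 'n)"
  by (simp add: vec_eq_iff)

lemma vec_add_eq_0_iff: "v + w = 0 \<longleftrightarrow> v = (w :: bit ^ 'n)"
  by (metis add.right_neutral add.assoc add.left_neutral vec_add_self)

lemma vec_eq_if_support_eq:
  fixes v w :: "bit ^ 'n"
  assumes "{j. v $ j \<noteq> 0} = {j. w $ j \<noteq> 0}"
  shows "v = w"
  unfolding vec_eq_iff
proof
  fix j
  have "v $ j \<noteq> 0 \<longleftrightarrow> w $ j \<noteq> 0" using assms by blast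
  thus "v $ j = w $ j" by (cases "v $ j"; cases "w $ j") simp_all
qed

lemma pairing_add_left: "pairing (u + v) w = pairing u w + pairing v w"
  by (simp only: pairing_def vector_add_component distrib_right sum.distrib)

lemma pairing_add_right: "pairing u (v + w) = pairing u v + pairing u w"
  by (simp only: pairing_def vector_add_component distrib_left sum.distrib)

lemma pairing_commute: "pairing v w = pairing w v"
  unfolding pairing_def by (intro sum.cong refl) (rule mult.commute)

lemma pairing_0 [simp]: "pairing 0 v = 0" "pairing v 0 = 0"
  by (simp_all add: pairing_def)

lemma pairing_axis: "pairing (axis i 1) v = v $ i"
proof -
  have "pairing (axis i 1) v = (\<Sum>j\<in>UNIV. if j = i then v $ j else 0)"
    unfolding pairing_def by (intro sum.cong) (auto simp: axis_def)
  thus ?thesis by simp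
qed

lemma pairing_eq_overlap:
  "pairing v w = of_nat (card {j. v $ j \<noteq> 0 \<and> w $ j \<noteq> 0})"
proof -
  have "pairing v w = (\<Sum>j\<in>UNIV. of_bool (v $ j \<noteq> 0 \<and> w $ j \<noteq> 0))"
    unfolding pairing_def
  proof (intro sum.cong refl)
    fix j show "v $ j * w $ j = of_bool (v $ j \<noteq> 0 \<and> w $ j \<noteq> 0)"
      by (cases "v $ j"; cases "w $ j") simp_all
  qed
  thus ?thesis by (simp del: bit_not_zero_iff)
qed

lemma pairing_self: "pairing v v = of_nat (hamming_weight v)"
  by (simp add: pairing_eq_overlap hamming_weight_def)

lemma pairing_one: "pairing v 1 = of_nat (hamming_weight v)"
  by (simp add: pairing_eq_overlap hamming_weight_def)

lemma hamming_weight_add: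
  fixes v w :: "bit ^ 'n"
  shows "hamming_weight (v + w) + 2 * card {j. v $ j \<noteq> 0 \<and> w $ j \<noteq> 0}
    = hamming_weight v + hamming_weight w"
proof -
  let ?A = "{j. v $ j \<noteq> 0}" and ?B = "{j. w $ j \<noteq> 0}"
  have "(v + w) $ j \<noteq> 0 \<longleftrightarrow> (v $ j \<noteq> 0) \<noteq> (w $ j \<noteq> 0)" for j
    by (cases "v $ j"; cases "w $ j") simp_all
  hence sym_diff: "{j. (v + w) $ j \<noteq> 0} = (?A - ?A \<inter> ?B) \<union> (?B - ?A \<inter> ?B)"
    by blast
  have le: "card (?A \<inter> ?B) \<le> card ?A" "card (?A \<inter> ?B) \<le> card ?B"
    by (auto intro: card_mono)
  have "card {j. (v + w) $ j \<noteq> 0} = card (?A - ?A \<inter> ?B) + card (?B - ?A \<inter> ?B)"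
    unfolding sym_diff by (intro card_Un_disjoint) auto
  also have "card (?A - ?A \<inter> ?B) = card ?A - card (?A \<inter> ?B)"
    by (intro card_Diff_subset) auto
  also have "card (?B - ?A \<inter> ?B) = card ?B - card (?A \<inter> ?B)"
    by (intro card_Diff_subset) auto
  finally show ?thesis
    unfolding hamming_weight_def using le by (simp only: Collect_conj_eq)
qed

lemma hamming_weight_eq_0_iff: "hamming_weight v = 0 \<longleftrightarrow> v = 0"
  by (simp add: hamming_weight_def vec_eq_iff)

lemma hamming_weight_0 [simp]: "hamming_weight 0 = 0"
  by (simp add: hamming_weight_eq_0_iff)

text \<open>This is a Gauss sum; the summand is a product over the coordinates, so the sum factors
  into \<open>n\<close> sums over a single bit.\<close>

lemma sum_ii_power_hamming_weight:
  "(\<Sum>v\<in>(UNIV :: (bit ^ 'n) set). \<i> ^ hamming_weight v) = (1 + \<i>) ^ CARD('n)"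
proof -
  have factor: "\<i> ^ hamming_weight v = (\<Prod>j\<in>UNIV. if v $ j = 0 then 1 else \<i>)"
    for v :: "bit ^ 'n"
    by (simp add: prod.If_cases hamming_weight_def Collect_neg_eq[symmetric]
        del: bit_not_zero_iff)
  have "(\<Sum>v\<in>(UNIV :: (bit ^ 'n) set). \<i> ^ hamming_weight v)
      = (\<Sum>g\<in>UNIV. \<Prod>j\<in>(UNIV :: 'n set). if g j = (0 :: bit) then 1 else \<i>)"
    unfolding factor
    by (rule sum.reindex_bij_witness[of _ vec_lambda vec_nth]) auto
  also have "\<dots> = (\<Prod>j\<in>(UNIV :: 'n set). \<Sum>b\<in>(UNIV :: bit set). if b = 0 then 1 else \<i>)"
    by (subst prod_sum_PiE) (simp_all add: PiE_UNIV_domain)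
  also have "\<dots> = (1 + \<i>) ^ CARD('n)"
    by (simp add: UNIV_bit)
  finally show ?thesis .
qed

text \<open>Orthogonality of characters: if the character is nontrivial at some \<open>a \<in> A\<close>, then
  translation by \<open>a\<close> negates the sum.\<close>

lemma sum_bit_sign_additive:
  fixes A :: "(bit ^ 'n) set" and f :: "bit ^ 'n \<Rightarrow> bit"
  assumes closed: "\<And>v w. v \<in> A \<Longrightarrow> w \<in> A \<Longrightarrow> v + w \<in> A"
    and additive: "\<And>v w. v \<in> A \<Longrightarrow> w \<in> A \<Longrightarrow> f (v + w) = f v + f w"
  shows "(\<Sum>v\<in>A. bit_sign (f v) :: 'a::{idom,ring_char_0})
    = (if \<forall>v\<in>A. f v = 0 then of_nat (card A) else 0)"
proof (cases "\<forall>v\<in>A. f v = 0")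
  case False
  then obtain a where a: "a \<in> A" "f a = 1" by auto
  have "(\<Sum>v\<in>A. bit_sign (f v) :: 'a) = (\<Sum>v\<in>A. bit_sign (f (a + v)))"
    by (rule sum.reindex_bij_witness[of _ "(+) a" "(+) a"])
      (auto simp: closed a(1) add.assoc[symmetric])
  also have "\<dots> = - (\<Sum>v\<in>A. bit_sign (f v))"
    unfolding sum_negf[symmetric] using a
    by (intro sum.cong) (simp_all add: additive bit_sign_add)
  finally have "(\<Sum>v\<in>A. bit_sign (f v) :: 'a) = 0"
    by (metis eq_neg_iff_add_eq_0 mult_2 mult_eq_0_iff zero_neq_numeral)
  thus ?thesis using False by auto
qed simp

lemma sum_all_pairing:
  "(\<Sum>v\<in>UNIV. bit_sign (pairing c v) :: 'a::{idom,ring_char_0})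
    = (if c = 0 then 2 ^ CARD('n) else 0)" for c :: "bit ^ 'n"
proof -
  have trivial: "(\<forall>v\<in>UNIV. pairing c v = 0) \<longleftrightarrow> c = 0"
    using pairing_axis[of _ c] pairing_commute[of c] by (metis UNIV_I vec_eq_iff zero_index pairing_0(1))
  have "(\<Sum>v\<in>UNIV. bit_sign (pairing c v) :: 'a)
      = (if \<forall>v\<in>UNIV. pairing c v = 0 then of_nat CARD(bit ^ 'n) else 0)"
    by (rule sum_bit_sign_additive) (simp_all only: UNIV_I pairing_add_right)
  thus ?thesis
    unfolding trivial by (simp add: UNIV_bit)
qed

section \<open>Sums of four unit vectors\<close>

definition unit_sum :: "'n \<times> 'n \<times> 'n \<times> 'n \<Rightarrow> bit ^ 'n" where
  "unit_sum = (\<lambda>(i, j, k, l). axis i 1 + axis j 1 + axis k 1 + axis l 1)"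

lemma axis_bit_inject: "axis i (1::bit) = axis j 1 \<longleftrightarrow> i = j"
  by (simp add: axis_eq_axis)

lemma hamming_weight_two_units:
  assumes "i \<noteq> j"
  shows "hamming_weight (axis i 1 + axis j 1 :: bit ^ 'n) = 2"
proof -
  have "{m. (axis i 1 + axis j 1 :: bit ^ 'n) $ m \<noteq> 0} = {i, j}"
    using assms by (auto simp: axis_def)
  thus ?thesis
    using assms by (simp add: hamming_weight_def)
qed

lemma unit_sum_distinct:
  assumes "distinct [i, j, k, l]"
  shows "{m. unit_sum (i, j, k, l) $ m \<noteq> 0} = {i, j, k, l}"
  using assms by (auto simp: unit_sum_def axis_def)

lemma vec_add_cancel:
  fixes u v w :: "bit ^ 'n"
  shows "u + u + v + w = v + w" "u + v + u + w = v + w" "u + v + w + u = v + w"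
    "v + u + u + w = v + w" "v + u + w + u = v + w" "v + w + u + u = v + w"
proof -
  have "a + a + b + c = b + c" "a + b + a + c = b + c" "a + b + c + a = b + c"
    "b + a + a + c = b + c" "b + a + c + a = b + c" "b + c + a + a = b + c" for a b c :: bit
    by (cases a; cases b; cases c; simp)+
  thus "u + u + v + w = v + w" "u + v + u + w = v + w" "u + v + w + u = v + w"
    "v + u + u + w = v + w" "v + u + w + u = v + w" "v + w + u + u = v + w"
    unfolding vec_eq_iff vector_add_component by blast+
qed

lemma unit_sum_not_distinct:
  assumes "\<not> distinct [i, j, k, l]"
  obtains a b where "unit_sum (i, j, k, l) = axis a 1 + axis b 1"
proof -
  from assms consider "i = j" | "i = k" | "i = l" | "j = k" | "j = l" | "k = l"
    by auto
  thus thesis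
    by cases (rule that; simp only: unit_sum_def prod.case vec_add_cancel)+
qed

text \<open>If two of the four unit vectors coincide, they cancel and leave two.\<close>

lemma unit_sum_cases:
  "unit_sum q = 0 \<or> hamming_weight (unit_sum q) = 2 \<or> hamming_weight (unit_sum q) = 4"
proof -
  obtain i j k l where q: "q = (i, j, k, l)" by (cases q)
  show ?thesis
  proof (cases "distinct [i, j, k, l]")
    case True
    thus ?thesis
      unfolding q hamming_weight_def unit_sum_distinct[OF True] by simp
  next
    case False
    then obtain a b where ab: "unit_sum q = axis a 1 + axis b 1"
      unfolding q by (rule unit_sum_not_distinct)
    show ?thesis
      unfolding ab by (cases "a = b") (simp_all add: hamming_weight_two_units)
  qed
qed

lemma unit_sum_eq_0_iff:
  "unit_sum (i, j, k, l) = 0 \<longleftrightarrow> i = j \<and> k = l \<or> i = k \<and> j = l \<or> i = l \<and> j = k"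
proof
  assume zero: "unit_sum (i, j, k, l) = 0"
  have pair: "axis a (1 :: bit) + axis b 1 = 0 \<longleftrightarrow> a = b" for a b
    by (simp add: vec_add_eq_0_iff axis_bit_inject)
  have "\<not> distinct [i, j, k, l]"
    using unit_sum_distinct[of i j k l] zero by auto
  then consider "i = j" | "i = k" | "i = l" | "j = k" | "j = l" | "k = l"
    by auto
  thus "i = j \<and> k = l \<or> i = k \<and> j = l \<or> i = l \<and> j = k"
    by cases (use zero in \<open>simp only: unit_sum_def prod.case vec_add_cancel pair; simp\<close>)+
next
  assume "i = j \<and> k = l \<or> i = k \<and> j = l \<or> i = l \<and> j = k"
  thus "unit_sum (i, j, k, l) = 0"
    by (elim disjE conjE) (simp_all only: unit_sum_def prod.case vec_add_cancel vec_add_self add_0_left)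
qed

text \<open>Four unit vectors cancel exactly if they match up in pairs. Each of the three pairings of
  the positions allows \<open>n\<^sup>2\<close> quadruples; the \<open>n\<close> constant quadruples belong to all three, so
  two of the three times that they are counted must be subtracted.\<close>

lemma card_unit_sum_eq_0:
  "real (card {q :: 'n::finite \<times> 'n \<times> 'n \<times> 'n. unit_sum q = 0})
    = 3 * (real CARD('n))\<^sup>2 - 2 * real CARD('n)"
proof -
  let ?n = "CARD('n)"
  define A where "A = (\<lambda>(i, k). (i, i, k, k)) ` (UNIV :: ('n \<times> 'n) set)"
  define B where "B = (\<lambda>(i, j). (i, j, i, j)) ` (UNIV :: ('n \<times> 'n) set)"
  define D where "D = (\<lambda>(i, j). (i, j, j, i)) ` (UNIV :: ('n \<times> 'n) set)"
  define E where "E = (\<lambda>i. (i, i, i, i)) ` (UNIV :: 'n set)"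
  have cards: "card A = ?n * ?n" "card B = ?n * ?n" "card D = ?n * ?n" "card E = ?n"
    unfolding A_def B_def D_def E_def
    by (subst card_image; auto simp: inj_on_def)+
  have sub: "E \<subseteq> B" "E \<subseteq> D"
    unfolding B_def D_def E_def by auto
  have split: "{q. unit_sum q = 0} = A \<union> (B - E) \<union> (D - E)"
    unfolding A_def B_def D_def E_def by (auto simp: unit_sum_eq_0_iff image_iff)
  have "card {q :: 'n \<times> 'n \<times> 'n \<times> 'n. unit_sum q = 0} = card (A \<union> (B - E)) + card (D - E)"
    unfolding split by (intro card_Un_disjoint) (auto simp: A_def B_def D_def E_def)
  also have "card (A \<union> (B - E)) = card A + card (B - E)"
    by (intro card_Un_disjoint) (auto simp: A_def B_def D_def E_def)
  also have "card (B - E) = card B - card E"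
    using sub by (intro card_Diff_subset) auto
  also have "card (D - E) = card D - card E"
    using sub by (intro card_Diff_subset) auto
  finally have "card {q :: 'n \<times> 'n \<times> 'n \<times> 'n. unit_sum q = 0}
      = ?n * ?n + (?n * ?n - ?n) + (?n * ?n - ?n)"
    by (simp add: cards)
  moreover have "?n \<le> ?n * ?n" by simp
  ultimately have "card {q :: 'n \<times> 'n \<times> 'n \<times> 'n. unit_sum q = 0} + 2 * ?n = 3 * (?n * ?n)"
    by linarith
  hence "real (card {q :: 'n \<times> 'n \<times> 'n \<times> 'n. unit_sum q = 0}) + 2 * real ?n = 3 * (real ?n * real ?n)"
    by (metis of_nat_add of_nat_mult of_nat_numeral)
  thus ?thesis by (simp add: power2_eq_square)
qed

text \<open>The quadruples are the \<open>4! = 24\<close> orderings of the support.\<close>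

lemma card_unit_sum_eq_weight_4:
  fixes c :: "bit ^ 'n"
  assumes weight: "hamming_weight c = 4"
  shows "card {q. unit_sum q = c} = 24"
proof -
  let ?supp = "{m. c $ m \<noteq> 0}"
  have "bij_betw (\<lambda>(i, j, k, l). [i, j, k, l]) {q. unit_sum q = c} (permutations_of_set ?supp)"
  proof (rule bij_betw_imageI)
    show "inj_on (\<lambda>(i, j, k, l). [i, j, k, l]) {q. unit_sum q = c}"
      by (auto simp: inj_on_def)
    show "(\<lambda>(i, j, k, l). [i, j, k, l]) ` {q. unit_sum q = c} = permutations_of_set ?supp"
    proof (intro equalityI subsetI)
      fix xs assume "xs \<in> (\<lambda>(i, j, k, l). [i, j, k, l]) ` {q. unit_sum q = c}"
      then obtain i j k l where xs: "xs = [i, j, k, l]" and c: "unit_sum (i, j, k, l) = c"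
        by auto
      have dist: "distinct [i, j, k, l]"
      proof (rule ccontr)
        assume "\<not> distinct [i, j, k, l]"
        then obtain a b where "c = axis a 1 + axis b 1"
          using unit_sum_not_distinct c by metis
        thus False
          using weight by (cases "a = b") (simp_all add: hamming_weight_two_units)
      qed
      show "xs \<in> permutations_of_set ?supp"
        using dist unit_sum_distinct[OF dist] by (intro permutations_of_setI) (auto simp: xs c)
    next
      fix xs assume "xs \<in> permutations_of_set ?supp"
      hence xs: "set xs = ?supp" "distinct xs"
        by (auto simp: permutations_of_set_def)
      hence "length xs = 4"
        using weight distinct_card[of xs] by (simp add: hamming_weight_def)
      then obtain i j k l where ijkl: "xs = [i, j, k, l]"
        by (auto simp: numeral_eq_Suc length_Suc_conv)
      have "{m. unit_sum (i, j, k, l) $ m \<noteq> 0} = ?supp"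
        using xs unit_sum_distinct[of i j k l] by (simp add: ijkl)
      hence "unit_sum (i, j, k, l) = c"
        by (rule vec_eq_if_support_eq)
      thus "xs \<in> (\<lambda>(i, j, k, l). [i, j, k, l]) ` {q. unit_sum q = c}"
        by (force simp: ijkl)
    qed
  qed
  hence "card {q. unit_sum q = c} = card (permutations_of_set ?supp)"
    by (rule bij_betw_same_card)
  also have "\<dots> = fact 4"
    using weight by (simp add: hamming_weight_def)
  also have "fact 4 = (24 :: nat)"
    by (simp add: fact_numeral)
  finally show ?thesis .
qed

lemma imbalance_power_4:
  "imbalance v ^ 4 = (\<Sum>q\<in>UNIV. bit_sign (pairing (unit_sum q) v))" for v :: "bit ^ 'n"
proof -
  let ?f = "\<lambda>i. bit_sign (v $ i) :: real"
  have "imbalance v ^ 4 = imbalance v * (imbalance v * (imbalance v * imbalance v))"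
    by (simp add: power4_eq_xxxx mult.assoc)
  also have "\<dots> = (\<Sum>i\<in>UNIV. \<Sum>j\<in>UNIV. \<Sum>k\<in>UNIV. \<Sum>l\<in>UNIV. ?f i * (?f j * (?f k * ?f l)))"
    unfolding imbalance_def by (simp only: sum_distrib_left[symmetric] sum_distrib_right[symmetric])
  also have "\<dots> = (\<Sum>(i, j, k, l)\<in>UNIV \<times> UNIV \<times> UNIV \<times> UNIV. ?f i * (?f j * (?f k * ?f l)))"
    by (simp only: sum.cartesian_product)
  also have "\<dots> = (\<Sum>q\<in>UNIV. bit_sign (pairing (unit_sum q) v))"
    by (intro sum.cong) (auto simp only: unit_sum_def prod.case pairing_add_left
        pairing_axis bit_sign_add mult.assoc UNIV_Times_UNIV)
  finally show ?thesis .
qed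

section \<open>A self-dual code and its shadow\<close>

context
  fixes C :: "(bit ^ 'n) set"
  assumes self_dual: "self_dual_code C"
begin

lemma code_add: "v \<in> C \<Longrightarrow> w \<in> C \<Longrightarrow> v + w \<in> C"
  using self_dual by (simp add: self_dual_code_def vec.subspace_add)

lemma zero_in_code: "0 \<in> C"
  using self_dual by (simp add: self_dual_code_def vec.subspace_0)

lemma in_code_iff: "v \<in> C \<longleftrightarrow> (\<forall>c\<in>C. pairing c v = 0)"
  using self_dual by (auto simp: self_dual_code_def annihilator_def pairing_commute)

lemma even_weight: "c \<in> C \<Longrightarrow> even (hamming_weight c)"
  using in_code_iff[of c] pairing_self[of c] by (metis even_of_nat_iff dvd_0_right)

text \<open>Pairing with the all-ones word agrees with the map \<open>c \<mapsto> (c, c)\<close>, which vanishes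
  on \<open>C\<close>.\<close>

lemma one_in_code: "1 \<in> C"
  unfolding in_code_iff[of 1] pairing_one
  using in_code_iff pairing_self by metis

lemma even_length: "even CARD('n)"
  using even_weight[OF one_in_code] by (simp add: hamming_weight_def)

text \<open>The overlap of two codewords is even, so it drops out of
  \<open>wt(c + d) / 2 = wt(c) / 2 + wt(d) / 2 - |c \<inter> d|\<close> modulo 2.\<close>

lemma half_weight_add:
  assumes "c \<in> C" "d \<in> C"
  shows "half_weight (c + d) = half_weight c + half_weight d"
proof -
  let ?o = "card {j. c $ j \<noteq> 0 \<and> d $ j \<noteq> 0}"
  have "even (of_nat ?o :: bit)"
    using assms in_code_iff pairing_eq_overlap[of c d] by (metis dvd_0_right)
  hence "even ?o" by (simp only: even_of_nat_iff)
  obtain a b m where halves: "hamming_weight c = 2 * a" "hamming_weight d = 2 * b"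
      "hamming_weight (c + d) = 2 * m"
    using assms even_weight code_add by (metis evenE)
  hence "m + ?o = a + b"
    using hamming_weight_add[of c d] by linarith
  hence "even m \<longleftrightarrow> even (a + b)"
    using \<open>even ?o\<close> by (metis even_add)
  hence "even (of_nat m :: bit) \<longleftrightarrow> even (of_nat (a + b) :: bit)"
    by (simp only: even_of_nat_iff)
  hence "of_nat m = (of_nat (a + b) :: bit)"
    by (cases "of_nat m :: bit"; cases "of_nat (a + b) :: bit") simp_all
  thus ?thesis
    by (simp only: half_weight_def halves of_nat_add nonzero_mult_div_cancel_left
        zero_neq_numeral[symmetric] not_False_eq_True simp_thms)
qed

text \<open>In characteristic 2 this rewrites the defining equation of the shadow as the triviality of one
  character of \<open>C\<close>, the form to which orthogonality applies.\<close>

lemma in_shadow_iff: "s \<in> shadow C \<longleftrightarrow> (\<forall>c\<in>C. half_weight c + pairing c s = 0)"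
proof -
  have "half_weight c + pairing c s = 0 \<longleftrightarrow> half_weight c = pairing c s" for c
    by (cases "half_weight c"; cases "pairing c s") simp_all
  thus ?thesis by (simp add: shadow_def half_weight_def)
qed

lemma shadow_add_code: "s \<in> shadow C \<Longrightarrow> c \<in> C \<Longrightarrow> s + c \<in> shadow C"
  using in_code_iff[of c] by (simp add: in_shadow_iff pairing_add_right)

lemma shadow_add_shadow:
  assumes "s \<in> shadow C" "s' \<in> shadow C"
  shows "s + s' \<in> C"
  unfolding in_code_iff[of "s + s'"] pairing_add_right
proof
  fix c assume "c \<in> C"
  thus "pairing c s + pairing c s' = 0"
    using assms by (simp add: shadow_def)
qed

lemma sum_code_pairing:
  "(\<Sum>c\<in>C. bit_sign (pairing c v) :: 'a::{idom,ring_char_0})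
    = (if v \<in> C then of_nat (card C) else 0)"
  unfolding in_code_iff[of v]
  by (rule sum_bit_sign_additive) (simp_all only: code_add pairing_add_left)

lemma sum_code_half_weight_pairing:
  "(\<Sum>c\<in>C. bit_sign (half_weight c + pairing c v) :: 'a::{idom,ring_char_0})
    = (if v \<in> shadow C then of_nat (card C) else 0)"
  unfolding in_shadow_iff[of v]
  by (rule sum_bit_sign_additive)
    (simp_all only: code_add half_weight_add pairing_add_left ac_simps)

lemma card_code_pos: "0 < card C"
  using zero_in_code by (auto simp: card_gt_0_iff)

text \<open>The signs \<open>(-1) ^ (c, v)\<close> are summed over all pairs of a codeword \<open>c\<close> and a vector
  \<open>v\<close> in both orders.\<close>

lemma card_code_squared: "real (card C) ^ 2 = 2 ^ CARD('n)"
proof -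
  have "real (card C) ^ 2 = (\<Sum>v\<in>UNIV. if v \<in> C then real (card C) else 0)"
    by (simp add: sum.If_cases power2_eq_square)
  also have "\<dots> = (\<Sum>v\<in>UNIV. \<Sum>c\<in>C. bit_sign (pairing c v))"
    by (simp add: sum_code_pairing)
  also have "\<dots> = (\<Sum>c\<in>C. \<Sum>v\<in>UNIV. bit_sign (pairing c v))"
    by (rule sum.swap)
  also have "\<dots> = 2 ^ CARD('n)"
    using zero_in_code by (simp add: sum_all_pairing)
  finally show ?thesis .
qed

lemma card_code: "card C = 2 ^ (CARD('n) div 2)"
proof -
  have "real (card C) ^ 2 = (2 ^ (CARD('n) div 2)) ^ 2"
    unfolding card_code_squared using even_length by (simp add: power_mult[symmetric])
  hence "real (card C) = 2 ^ (CARD('n) div 2)"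
    by (subst (asm) power2_eq_iff_nonneg) auto
  thus ?thesis
    by (metis of_nat_eq_iff of_nat_numeral of_nat_power)
qed

text \<open>By \<open>sum_code_half_weight_pairing\<close> the indicator function of the shadow is, up to the
  factor \<open>|C|\<close>, the Fourier transform of \<open>(-1) ^ (wt(c) / 2)\<close> on \<open>C\<close>; Fourier inversion
  gives that function back. In particular (\<open>w = 0\<close>) the shadow has as many elements as
  \<open>C\<close>.\<close>

lemma sum_shadow_pairing:
  "(\<Sum>s\<in>shadow C. bit_sign (pairing w s) :: real)
    = (if w \<in> C then real (card C) * bit_sign (half_weight w) else 0)"
proof -
  have "real (card C) * (\<Sum>s\<in>shadow C. bit_sign (pairing w s))
      = (\<Sum>v\<in>UNIV. (if v \<in> shadow C then real (card C) else 0) * bit_sign (pairing w v))"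
    by (simp add: if_distrib[of "\<lambda>x. x * _"] sum.If_cases sum_distrib_left)
  also have "\<dots> = (\<Sum>v\<in>UNIV. \<Sum>c\<in>C. bit_sign (half_weight c) * bit_sign (pairing (c + w) v))"
    unfolding sum_code_half_weight_pairing[symmetric] sum_distrib_right
    by (simp only: bit_sign_add pairing_add_left mult.assoc)
  also have "\<dots> = (\<Sum>c\<in>C. bit_sign (half_weight c) * (\<Sum>v\<in>UNIV. bit_sign (pairing (c + w) v)))"
    by (subst sum.swap) (simp add: sum_distrib_left)
  also have "\<dots> = (\<Sum>c\<in>C. if c = w then bit_sign (half_weight c) * 2 ^ CARD('n) else 0)"
    by (intro sum.cong) (simp_all add: sum_all_pairing vec_add_eq_0_iff)
  also have "\<dots> = (if w \<in> C then bit_sign (half_weight w) * real (card C) ^ 2 else 0)"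
    by (simp add: card_code_squared)
  finally show ?thesis
    using card_code_pos by (auto simp: power2_eq_square)
qed

lemma card_shadow: "card (shadow C) = card C"
  using sum_shadow_pairing[of 0] zero_in_code by (simp add: half_weight_def)

lemma ii_power_weight_add:
  assumes "c \<in> C"
  shows "\<i> ^ hamming_weight (v + c)
    = \<i> ^ hamming_weight v * bit_sign (half_weight c + pairing c v)"
proof -
  let ?o = "card {j. v $ j \<noteq> 0 \<and> c $ j \<noteq> 0}"
  obtain m where m: "hamming_weight c = 2 * m"
    using even_weight[OF assms] by blast
  have "\<i> ^ hamming_weight (v + c) * (- 1) ^ ?o = \<i> ^ (hamming_weight (v + c) + 2 * ?o)"
    by (simp add: power_add power_mult)
  also have "\<dots> = \<i> ^ hamming_weight v * (- 1) ^ m"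
    by (simp only: hamming_weight_add m power_add power_mult power2_i)
  finally have eq: "\<i> ^ hamming_weight (v + c) * (- 1) ^ ?o = \<i> ^ hamming_weight v * (- 1) ^ m" .
  have sq: "(- 1) ^ ?o * (- 1) ^ ?o = (1 :: complex)"
    by (simp only: power_add[symmetric] mult_2[symmetric] power_mult power2_minus power_one)
  have "\<i> ^ hamming_weight (v + c) = \<i> ^ hamming_weight (v + c) * (- 1) ^ ?o * (- 1) ^ ?o"
    by (simp only: mult.assoc sq mult_1_right)
  also have "\<dots> = \<i> ^ hamming_weight v * ((- 1) ^ m * (- 1) ^ ?o)"
    by (simp only: eq mult.assoc)
  finally show ?thesis
    unfolding bit_sign_add half_weight_def pairing_eq_overlap bit_sign_of_nat
    by (simp only: m nonzero_mult_div_cancel_left zero_neq_numeral[symmetric] not_False_eq_True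
        simp_thms conj_commute)
qed

text \<open>Averaging \<open>\<i> ^ wt\<close> over translations by \<open>C\<close> does not change its sum over the whole space,
  but kills every vector outside the shadow. On the shadow, which is one coset of \<open>C\<close>, the
  function \<open>\<i> ^ wt\<close> is constant; so the Gauss sum determines its value.\<close>

lemma ii_power_weight_shadow:
  assumes s: "s \<in> shadow C"
  shows "of_nat (card C) * \<i> ^ hamming_weight s = (1 + \<i>) ^ CARD('n)"
proof -
  let ?f = "\<lambda>v :: bit ^ 'n. \<i> ^ hamming_weight v"
  have const: "?f s' = ?f s" if "s' \<in> shadow C" for s'
  proof -
    have c: "s + s' \<in> C" using shadow_add_shadow s that by blast
    have "?f s' = ?f (s + (s + s'))" by (simp add: add.assoc[symmetric])
    also have "\<dots> = ?f s"
      unfolding ii_power_weight_add[OF c] using s c in_shadow_iff by simp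
    finally show ?thesis .
  qed
  have "of_nat (card C) * (\<Sum>v\<in>UNIV. ?f v) = (\<Sum>c\<in>C. \<Sum>v\<in>UNIV. ?f (v + c))"
  proof -
    have "(\<Sum>v\<in>UNIV. ?f (v + c)) = (\<Sum>v\<in>UNIV. ?f v)" for c
      by (rule sum.reindex_bij_witness[of _ "\<lambda>v. v + c" "\<lambda>v. v + c"]) (auto simp: add.assoc)
    thus ?thesis by simp
  qed
  also have "\<dots> = (\<Sum>v\<in>UNIV. \<Sum>c\<in>C. ?f (v + c))"
    by (rule sum.swap)
  also have "\<dots> = (\<Sum>v\<in>UNIV. ?f v * (\<Sum>c\<in>C. bit_sign (half_weight c + pairing c v)))"
    by (simp add: ii_power_weight_add sum_distrib_left)
  also have "\<dots> = (\<Sum>v\<in>UNIV. if v \<in> shadow C then ?f v * of_nat (card C) else 0)"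
    unfolding sum_code_half_weight_pairing by (intro sum.cong) auto
  also have "\<dots> = (\<Sum>v\<in>shadow C. ?f s * of_nat (card C))"
    by (subst sum.inter_filter[symmetric]) (auto intro!: sum.cong simp: const)
  also have "\<dots> = of_nat (card C) * (of_nat (card C) * ?f s)"
    by (simp add: card_shadow)
  finally show ?thesis
    using card_code_pos by (auto simp: sum_ii_power_hamming_weight)
qed

text \<open>With \<open>n = 2 m\<close> the previous equation reads \<open>2 ^ m * \<i> ^ wt(s) = (2 * \<i>) ^ m\<close>, and
  \<open>\<i>\<close> has order 4.\<close>

lemma shadow_weight_mod_4:
  assumes "s \<in> shadow C"
  shows "hamming_weight s mod 4 = (CARD('n) div 2) mod 4"
proof -
  define m where "m = CARD('n) div 2"
  have n: "CARD('n) = 2 * m" using even_length by (simp add: m_def)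
  have "(1 + \<i>) ^ 2 = 2 * \<i>"
    by (simp add: power2_eq_square algebra_simps)
  hence "2 ^ m * \<i> ^ hamming_weight s = 2 ^ m * \<i> ^ m"
    using ii_power_weight_shadow[OF assms]
    by (simp add: card_code m_def[symmetric] n power_mult power_mult_distrib)
  hence eq: "\<i> ^ hamming_weight s = \<i> ^ m" by simp
  have red: "\<i> ^ k = \<i> ^ (k mod 4)" for k
  proof -
    have "\<i> ^ k = \<i> ^ (4 * (k div 4) + k mod 4)" by simp
    also have "\<dots> = \<i> ^ (k mod 4)" unfolding power_add power_mult by simp
    finally show ?thesis .
  qed
  have inj: "a = b" if "\<i> ^ a = \<i> ^ b" "a < 4" "b < 4" for a b :: nat
  proof -
    have "a \<in> {0, 1, 2, 3}" "b \<in> {0, 1, 2, 3}" using that by auto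
    thus ?thesis using that(1)
      by (auto simp: power2_eq_square power3_eq_cube complex_eq_iff)
  qed
  show ?thesis
    using inj[of "hamming_weight s mod 4" "m mod 4"] eq red[of "hamming_weight s"] red[of m]
    by (simp add: m_def)
qed

lemma shadow_imbalance:
  assumes "s \<in> shadow C"
  obtains u :: int where "imbalance s = 8 * of_int u"
proof -
  define m where "m = CARD('n) div 2"
  have n: "CARD('n) = 2 * m" using even_length by (simp add: m_def)
  have "hamming_weight s mod 4 = m mod 4"
    using shadow_weight_mod_4[OF assms] by (simp add: m_def)
  hence "int m mod 4 = int (hamming_weight s) mod 4"
    by (metis of_nat_mod of_nat_numeral)
  hence "4 dvd int m - int (hamming_weight s)"
    by (rule mod_eq_dvd_iff[THEN iffD1])
  then obtain u where "int m - int (hamming_weight s) = 4 * u" by blast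
  hence "real m - real (hamming_weight s) = 4 * of_int u" by linarith
  hence "imbalance s = 8 * of_int u"
    by (simp add: imbalance_eq n)
  thus thesis by (rule that)
qed

lemma card_shadow_imbalance_minus:
  "card {s \<in> shadow C. imbalance s = - x} = card {s \<in> shadow C. imbalance s = x}"
  by (rule bij_betw_same_card, rule bij_betwI[of "\<lambda>s. s + 1" _ _ "\<lambda>s. s + 1"])
    (auto simp: imbalance_complement shadow_add_code one_in_code add.assoc)

section \<open>Moments of the imbalance over the shadow\<close>

text \<open>The sign at a sum of two unit vectors averages to 0 unless the two are equal, for
  otherwise the sum has weight 2 and is not a codeword.\<close>

lemma sum_imbalance_power_2:
  assumes no_weight_2: "\<forall>c\<in>C. hamming_weight c \<noteq> 2"
  shows "(\<Sum>s\<in>shadow C. imbalance s ^ 2) = real CARD('n) * real (card C)"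
proof -
  have "(\<Sum>s\<in>shadow C. imbalance s ^ 2)
      = (\<Sum>s\<in>shadow C. \<Sum>i\<in>UNIV. \<Sum>j\<in>UNIV. bit_sign (pairing (axis i 1 + axis j 1) s))"
    by (simp only: imbalance_def power2_eq_square sum_product pairing_add_left pairing_axis
        bit_sign_add)
  also have "\<dots> = (\<Sum>i\<in>UNIV. \<Sum>s\<in>shadow C. \<Sum>j\<in>UNIV. bit_sign (pairing (axis i 1 + axis j 1) s))"
    by (rule sum.swap)
  also have "\<dots> = (\<Sum>i\<in>UNIV. \<Sum>j\<in>UNIV. \<Sum>s\<in>shadow C. bit_sign (pairing (axis i 1 + axis j 1) s))"
    by (intro sum.cong refl sum.swap)
  also have "\<dots> = (\<Sum>i\<in>(UNIV :: 'n set). \<Sum>j\<in>UNIV. if j = i then real (card C) else 0)"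
  proof (intro sum.cong refl)
    fix i j :: 'n
    have "axis i 1 + axis j 1 \<notin> C" if "i \<noteq> j"
      using no_weight_2 hamming_weight_two_units[OF that] by blast
    thus "(\<Sum>s\<in>shadow C. bit_sign (pairing (axis i 1 + axis j 1) s))
        = (if j = i then real (card C) else 0)"
      by (auto simp: sum_shadow_pairing zero_in_code half_weight_def)
  qed
  also have "\<dots> = real CARD('n) * real (card C)" by simp
  finally show ?thesis .
qed

text \<open>The quadruples of unit vectors that sum to a codeword are those with sum 0 and 24 for each
  word of weight 4; each contributes \<open>|C|\<close> with a plus sign, as both 0 and 4 are divisible
  by 4.\<close>

lemma sum_imbalance_power_4:
  assumes no_weight_2: "\<forall>c\<in>C. hamming_weight c \<noteq> 2"
  shows "(\<Sum>s\<in>shadow C. imbalance s ^ 4) = real (card C)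
    * (3 * (real CARD('n))\<^sup>2 - 2 * real CARD('n) + 24 * real (card {c \<in> C. hamming_weight c = 4}))"
proof -
  let ?Z = "{q :: 'n \<times> 'n \<times> 'n \<times> 'n. unit_sum q = 0}"
  let ?C4 = "{c \<in> C. hamming_weight c = 4}"
  let ?F = "{q. unit_sum q \<in> ?C4}"
  have "(\<Sum>s\<in>shadow C. imbalance s ^ 4)
      = (\<Sum>q\<in>UNIV. \<Sum>s\<in>shadow C. bit_sign (pairing (unit_sum q) s))"
    unfolding imbalance_power_4 by (rule sum.swap)
  also have "\<dots> = (\<Sum>q\<in>UNIV. if q \<in> ?Z \<union> ?F then real (card C) else 0)"
  proof (intro sum.cong refl)
    fix q :: "'n \<times> 'n \<times> 'n \<times> 'n"
    show "(\<Sum>s\<in>shadow C. bit_sign (pairing (unit_sum q) s))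
        = (if q \<in> ?Z \<union> ?F then real (card C) else 0)"
      using unit_sum_cases[of q] no_weight_2
      by (auto simp: sum_shadow_pairing zero_in_code half_weight_def)
  qed
  also have "\<dots> = real (card C) * real (card (?Z \<union> ?F))"
    by (simp only: sum.If_cases finite Int_UNIV_left Collect_mem_eq sum_constant sum.neutral_const) simp
  also have "card (?Z \<union> ?F) = card ?Z + card ?F"
    by (intro card_Un_disjoint) auto
  also have "card ?F = 24 * card ?C4"
  proof -
    have "card ?F = card (\<Union>c\<in>?C4. {q. unit_sum q = c})"
      by (rule arg_cong[of _ _ card]) auto
    also have "\<dots> = (\<Sum>c\<in>?C4. card {q. unit_sum q = c})"
      by (intro card_UN_disjoint) auto
    also have "\<dots> = (\<Sum>c\<in>?C4. 24)"
      by (intro sum.cong) (auto simp: card_unit_sum_eq_weight_4)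
    finally show ?thesis by simp
  qed
  finally show ?thesis
    by (simp add: card_unit_sum_eq_0)
qed

text \<open>The polynomial \<open>t\<^sup>2 (t\<^sup>2 - 64)\<close> is chosen to vanish at the three multiples of 8
  closest to 0 and to be positive at all others.\<close>

lemma sum_imbalance_quartic:
  assumes no_weight_2: "\<forall>c\<in>C. hamming_weight c \<noteq> 2"
  shows "(\<Sum>s\<in>shadow C. imbalance s ^ 2 * (imbalance s ^ 2 - 64)) = 24 * real (card C)
    * (real (card {c \<in> C. hamming_weight c = 4}) - real CARD('n) * (22 - real CARD('n)) / 8)"
proof -
  have quartic: "t ^ 2 * (t ^ 2 - 64) = t ^ 4 - 64 * t ^ 2" for t :: real
    by (simp add: power2_eq_square power4_eq_xxxx algebra_simps)
  have collect: "k * (3 * m\<^sup>2 - 2 * m + 24 * a) - 64 * (m * k) = 24 * k * (a - m * (22 - m) / 8)"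
    for k m a :: real
    by (simp add: field_simps power2_eq_square)
  have "(\<Sum>s\<in>shadow C. imbalance s ^ 2 * (imbalance s ^ 2 - 64))
      = (\<Sum>s\<in>shadow C. imbalance s ^ 4) - 64 * (\<Sum>s\<in>shadow C. imbalance s ^ 2)"
    unfolding sum_distrib_left sum_subtractf[symmetric]
    by (intro sum.cong refl) (rule quartic)
  thus ?thesis
    unfolding sum_imbalance_power_2[OF no_weight_2] sum_imbalance_power_4[OF no_weight_2]
    by (simp only: collect)
qed

lemma imbalance_quartic_nonneg:
  assumes "s \<in> shadow C"
  shows "0 \<le> imbalance s ^ 2 * (imbalance s ^ 2 - 64)"
    and "imbalance s ^ 2 * (imbalance s ^ 2 - 64) = 0 \<longleftrightarrow> \<bar>imbalance s\<bar> \<le> 8"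
proof -
  obtain u where u: "imbalance s = 8 * of_int u"
    using shadow_imbalance[OF assms] .
  have scale: "(8 * x)\<^sup>2 * ((8 * x)\<^sup>2 - 64) = 4096 * (x\<^sup>2 * (x\<^sup>2 - 1))" for x :: real
    unfolding power2_eq_square by (simp add: algebra_simps)
  have factored: "imbalance s ^ 2 * (imbalance s ^ 2 - 64) = of_int (4096 * (u\<^sup>2 * (u\<^sup>2 - 1)))"
    unfolding u scale by (simp only: of_int_mult of_int_power of_int_diff of_int_1 of_int_numeral)
  have "u = 0 \<or> 0 < u\<^sup>2" by simp
  hence "0 \<le> u\<^sup>2 * (u\<^sup>2 - 1)"
    by (elim disjE) (simp_all add: int_one_le_iff_zero_less)
  thus "0 \<le> imbalance s ^ 2 * (imbalance s ^ 2 - 64)"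
    unfolding factored of_int_0_le_iff by simp
  have "imbalance s ^ 2 * (imbalance s ^ 2 - 64) = 0 \<longleftrightarrow> u\<^sup>2 * (u\<^sup>2 - 1) = 0"
    unfolding factored of_int_eq_0_iff by simp
  also have "\<dots> \<longleftrightarrow> u = 0 \<or> u = 1 \<or> u = - 1"
    by (simp add: power2_eq_1_iff)
  also have "\<dots> \<longleftrightarrow> \<bar>u\<bar> \<le> 1" by linarith
  also have "\<dots> \<longleftrightarrow> \<bar>imbalance s\<bar> \<le> 8" unfolding u abs_le_iff by linarith
  finally show "imbalance s ^ 2 * (imbalance s ^ 2 - 64) = 0 \<longleftrightarrow> \<bar>imbalance s\<bar> \<le> 8" .
qed

end

theorem mainTheorem2:
  fixes C :: "(bit ^ 'n) set" and n :: nat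
  assumes length: "n = CARD('n)"
    and self_dual: "self_dual_code C"
    and no_weight_2: "\<forall>c\<in>C. hamming_weight c \<noteq> 2"
  shows "real (card {c \<in> C. hamming_weight c = 4}) \<ge> real n * (22 - real n) / 8
    \<and> (real (card {c \<in> C. hamming_weight c = 4}) = real n * (22 - real n) / 8
         \<longleftrightarrow> \<not> (\<exists>s \<in> shadow C. real (hamming_weight s) < (real n - 8) / 2))
    \<and> (real (card {c \<in> C. hamming_weight c = 4}) = real n * (22 - real n) / 8
         \<longrightarrow> real (card {s \<in> shadow C. real (hamming_weight s) = (real n - 8) / 2})
             = 2 powr ((real n - 14) / 2) * real n)"
proof -
  let ?N = "real (card {c \<in> C. hamming_weight c = 4})"
  let ?q = "\<lambda>s. imbalance s ^ 2 * (imbalance s ^ 2 - 64)"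
  have sum_q: "(\<Sum>s\<in>shadow C. ?q s) = 24 * real (card C) * (?N - real n * (22 - real n) / 8)"
    using sum_imbalance_quartic[OF self_dual no_weight_2] by (simp add: length)
  have card_pos: "0 < real (card C)"
    using card_code_pos[OF self_dual] by simp
  have q_nonneg: "0 \<le> ?q s" if "s \<in> shadow C" for s
    using imbalance_quartic_nonneg(1)[OF self_dual that] .
  have "0 \<le> (\<Sum>s\<in>shadow C. ?q s)"
    by (intro sum_nonneg q_nonneg)
  hence bound: "?N \<ge> real n * (22 - real n) / 8"
    unfolding sum_q using card_pos by (auto simp: zero_le_mult_iff)
  have "?N = real n * (22 - real n) / 8 \<longleftrightarrow> (\<Sum>s\<in>shadow C. ?q s) = 0"
    unfolding sum_q using card_pos by auto
  also have "\<dots> \<longleftrightarrow> (\<forall>s\<in>shadow C. ?q s = 0)"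
    by (intro sum_nonneg_eq_0_iff q_nonneg) simp_all
  also have "\<dots> \<longleftrightarrow> (\<forall>s\<in>shadow C. \<bar>imbalance s\<bar> \<le> 8)"
    using imbalance_quartic_nonneg(2)[OF self_dual] by blast
  finally have equality_iff: "?N = real n * (22 - real n) / 8
      \<longleftrightarrow> (\<forall>s\<in>shadow C. \<bar>imbalance s\<bar> \<le> 8)" .
  have complement: "s + 1 \<in> shadow C" if "s \<in> shadow C" for s
    using shadow_add_code[OF self_dual that one_in_code[OF self_dual]] .
  have light_iff: "real (hamming_weight s) < (real n - 8) / 2 \<longleftrightarrow> 8 < imbalance s" for s :: "bit ^ 'n"
    unfolding imbalance_eq length by (simp add: field_simps)
  have no_light_iff: "\<not> (\<exists>s\<in>shadow C. real (hamming_weight s) < (real n - 8) / 2)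
      \<longleftrightarrow> (\<forall>s\<in>shadow C. \<bar>imbalance s\<bar> \<le> 8)"
  proof
    assume "\<not> (\<exists>s\<in>shadow C. real (hamming_weight s) < (real n - 8) / 2)"
    hence le: "imbalance s \<le> 8" if "s \<in> shadow C" for s
      using that light_iff[of s] by force
    show "\<forall>s\<in>shadow C. \<bar>imbalance s\<bar> \<le> 8"
    proof
      fix s assume "s \<in> shadow C"
      thus "\<bar>imbalance s\<bar> \<le> 8"
        using le[of s] le[OF complement, of s] imbalance_complement[of s] by linarith
    qed
  next
    assume "\<forall>s\<in>shadow C. \<bar>imbalance s\<bar> \<le> 8"
    thus "\<not> (\<exists>s\<in>shadow C. real (hamming_weight s) < (real n - 8) / 2)"
      unfolding light_iff by (metis abs_le_iff not_le)
  qed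
  have number: "real (card {s \<in> shadow C. real (hamming_weight s) = (real n - 8) / 2})
      = 2 powr ((real n - 14) / 2) * real n"
    if eq: "?N = real n * (22 - real n) / 8"
  proof -
    let ?P = "\<lambda>x. {s \<in> shadow C. imbalance s = x}"
    have square: "imbalance s ^ 2 = (if s \<in> ?P 8 \<union> ?P (- 8) then 64 else 0)"
      if s: "s \<in> shadow C" for s
    proof -
      have "?q s = 0"
        using imbalance_quartic_nonneg(2)[OF self_dual s] eq s equality_iff by blast
      hence "imbalance s = 0 \<or> imbalance s ^ 2 = 8 ^ 2" by auto
      thus ?thesis
        unfolding power2_eq_iff using s by auto
    qed
    have "real n * real (card C) = (\<Sum>s\<in>shadow C. imbalance s ^ 2)"
      using sum_imbalance_power_2[OF self_dual no_weight_2] by (simp add: length)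
    also have "\<dots> = (\<Sum>s\<in>shadow C. if s \<in> ?P 8 \<union> ?P (- 8) then 64 else 0)"
      by (intro sum.cong refl square)
    also have "\<dots> = 64 * real (card (shadow C \<inter> (?P 8 \<union> ?P (- 8))))"
      by (simp only: sum.If_cases finite Collect_mem_eq sum_constant sum.neutral_const)
    also have "shadow C \<inter> (?P 8 \<union> ?P (- 8)) = ?P 8 \<union> ?P (- 8)" by blast
    also have "card (?P 8 \<union> ?P (- 8)) = card (?P 8) + card (?P (- 8))"
      by (intro card_Un_disjoint) auto
    also have "card (?P (- 8)) = card (?P 8)"
      by (rule card_shadow_imbalance_minus[OF self_dual])
    finally have count: "real (card (?P 8)) = real (card C) * real n / 128"
      by (simp add: mult.commute)
    have "real (card C) = 2 powr (real n / 2)"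
      using card_code[OF self_dual] even_length[OF self_dual]
      by (simp add: length powr_realpow[symmetric] real_of_nat_div)
    moreover have "2 powr ((real n - 14) / 2) = 2 powr (real n / 2) / 128"
    proof -
      have "2 powr ((real n - 14) / 2) = 2 powr (real n / 2 - real 7)"
        by (simp add: diff_divide_distrib)
      also have "\<dots> = 2 powr (real n / 2) / 2 ^ 7"
        unfolding powr_diff by (subst powr_realpow) simp_all
      finally show ?thesis by simp
    qed
    moreover have "{s \<in> shadow C. real (hamming_weight s) = (real n - 8) / 2} = ?P 8"
      unfolding imbalance_eq length by (auto simp: field_simps)
    ultimately show ?thesis
      using count by (simp only: times_divide_eq_left)
  qed
  show ?thesis
    using bound number unfolding equality_iff no_light_iff by blast
qed

end
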